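(* Assume the following two statements: (a)$'$ Every nonmeager subset of $\mathbb{R}$ has a nonmeager subset of cardinality $\omega_1$. (b)$'$ For any everywhere nonmeager sets $A,B\subseteq\mathbb{R}$ of cardinality $\omega_1$ and any countable dense subsets $A_0\subseteq A$ and $B_0\subseteq B$, there is an order-isomorphism from $A$ onto $B$ which maps $A_0$ onto $B_0$. Then $\mathrm{cantor}(\omega^\omega)$ and $\mathrm{baire}(\omega^\omega)$ both hold.
   Context: A set $A\subseteq\mathbb{R}$ is everywhere nonmeager if $A\cap U$ is nonmeager for every nonempty open $U\subseteq\mathbb{R}$. $\omega^\omega$ is the Baire space. A Cantor set is a set homeomorphic to the Cantor middle-third set. $\mathrm{cantor}(\omega^\omega)$ is the statement: for every nonmeager $A\subseteq\omega^\omega$ there is a nowhere dense Cantor set $P\subseteq\omega^\omega$ such that $A\cap P$ is nonmeager relative to $P$. $\mathrm{baire}(\omega^\omega)$ is the statement: for every nonmeager $A\subseteq\omega^\omega$ there is a closed nowhere dense set $P\subseteq\omega^\omega$ homeomorphic to $\omega^\omega$ such that $A\cap P$ is nonmeager relative to $P$. *)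

theory Defs
  imports "HOL-Analysis.Analysis"
begin

unbundle cardinal_syntax

definition nowhere_dense_in :: "'a topology \<Rightarrow> 'a set \<Rightarrow> bool" where
  "nowhere_dense_in X S \<longleftrightarrow> S \<subseteq> topspace X \<and> X interior_of (X closure_of S) = {}"

definition meager_in :: "'a topology \<Rightarrow> 'a set \<Rightarrow> bool" where
  "meager_in X S \<longleftrightarrow> (\<exists>\<F>. countable \<F> \<and> (\<forall>T\<in>\<F>. nowhere_dense_in X T) \<and> S = \<Union>\<F>)"

definition nonmeager_in :: "'a topology \<Rightarrow> 'a set \<Rightarrow> bool" where
  "nonmeager_in X S \<longleftrightarrow> S \<subseteq> topspace X \<and> \<not> meager_in X S"

definition everywhere_nonmeager :: "real set \<Rightarrow> bool" where
  "everywhere_nonmeager A \<longleftrightarrow>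
     (\<forall>U. open U \<and> U \<noteq> {} \<longrightarrow> nonmeager_in euclidean (A \<inter> U))"

definition has_card_aleph1 :: "'a set \<Rightarrow> bool" where
  "has_card_aleph1 A \<longleftrightarrow> |A| =o cardSuc natLeq"

definition order_isomorphism :: "('a::order \<Rightarrow> 'b::order) \<Rightarrow> 'a set \<Rightarrow> 'b set \<Rightarrow> bool" where
  "order_isomorphism f A B \<longleftrightarrow>
     bij_betw f A B \<and> (\<forall>x\<in>A. \<forall>y\<in>A. x \<le> y \<longleftrightarrow> f x \<le> f y)"

text \<open>Stage \<open>n\<close> of the middle-third construction. Stage \<open>n + 1\<close> consists of the two copies of
  stage \<open>n\<close> scaled by one third, which is the same as removing the open middle third of every
  interval of stage \<open>n\<close>.\<close>

primrec cantor_stage :: "nat \<Rightarrow> real set" where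
  "cantor_stage 0 = {0..1}"
| "cantor_stage (Suc n) =
     (\<lambda>x. x / 3) ` cantor_stage n \<union> (\<lambda>x. x / 3 + 2 / 3) ` cantor_stage n"

definition middle_third_set :: "real set" where
  "middle_third_set = (\<Inter>n. cantor_stage n)"

definition is_Cantor_set :: "'a::topological_space set \<Rightarrow> bool" where
  "is_Cantor_set P \<longleftrightarrow> P homeomorphic middle_third_set"

text \<open>The Baire space is the type \<open>nat \<Rightarrow> nat\<close>, whose type-class topology is the
  product of the discrete topology on \<open>nat\<close>.\<close>

type_synonym baire_space = "nat \<Rightarrow> nat"

definition cantor_baire_space :: bool where
  "cantor_baire_space \<longleftrightarrow>
     (\<forall>A :: baire_space set. nonmeager_in euclidean A \<longrightarrow>
        (\<exists>P. is_Cantor_set P \<and> nowhere_dense_in euclidean P \<and>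
             nonmeager_in (top_of_set P) (A \<inter> P)))"

definition baire_baire_space :: bool where
  "baire_baire_space \<longleftrightarrow>
     (\<forall>A :: baire_space set. nonmeager_in euclidean A \<longrightarrow>
        (\<exists>P. closed P \<and> nowhere_dense_in euclidean P \<and>
             P homeomorphic (UNIV :: baire_space set) \<and>
             nonmeager_in (top_of_set P) (A \<inter> P)))"

end

theory Submission
  imports Defs
begin

text \<open>Identify the Baire space with the irrationals by a homeomorphism \<open>e\<close>. Given a nonmeager \<open>A\<close>,
  pick \<open>B \<subseteq> e ` A\<close> nonmeager of size \<open>\<aleph>\<^sub>1\<close>; its rational translates form an everywhere nonmeager
  set \<open>C\<close> of irrationals. Let \<open>N\<close> be the closed nowhere dense set of all \<open>v \<circ> x\<close>, where
  \<open>v : nat \<Rightarrow> nat\<close> is not surjective. Since \<open>x \<mapsto> v \<circ> x\<close> is continuous and open onto \<open>N\<close>, it maps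
  \<open>e\<^sup>-\<^sup>1(B)\<close> to a nonmeager subset \<open>M\<close> of \<open>N\<close>. An order isomorphism from \<open>C \<union> \<rat>\<close> onto
  \<open>C \<union> e ` M \<union> \<rat>\<close> fixing \<open>\<rat>\<close> setwise extends to a homeomorphism of the line, whose inverse \<open>k\<close>
  preserves the irrationals and maps \<open>e ` M\<close> into \<open>C\<close>. Hence countably many sets
  \<open>{m \<in> M. k (e m) - q \<in> B}\<close> cover \<open>M\<close>, one of them is nonmeager in \<open>N\<close>, and
  \<open>e\<^sup>-\<^sup>1 (k (e N) - q)\<close> is a copy of \<open>N\<close> in which \<open>A\<close> is nonmeager. Taking \<open>v i = i mod 2\<close> makes
  \<open>N\<close> a Cantor set, and taking \<open>v i = 2 * i\<close> makes it a copy of the Baire space.\<close>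

section \<open>Baire category\<close>

lemma nowhere_dense_in_subset:
  "nowhere_dense_in X S \<Longrightarrow> T \<subseteq> S \<Longrightarrow> nowhere_dense_in X T"
  unfolding nowhere_dense_in_def
  by (metis closure_of_mono interior_of_mono order_trans subset_empty)

text \<open>\<open>meager_in\<close> asks for an exact union, so the covering pieces are cut down to
  \<open>T\<close> first.\<close>

lemma meager_in_subset:
  assumes "meager_in X S" "T \<subseteq> S"
  shows "meager_in X T"
proof -
  obtain \<F> where \<F>: "countable \<F>" "\<And>F. F \<in> \<F> \<Longrightarrow> nowhere_dense_in X F" "S = \<Union>\<F>"
    using assms(1) unfolding meager_in_def by blast
  have "countable ((\<lambda>F. F \<inter> T) ` \<F>)" "\<And>F. F \<in> (\<lambda>F. F \<inter> T) ` \<F> \<Longrightarrow> nowhere_dense_in X F"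
    "T = \<Union> ((\<lambda>F. F \<inter> T) ` \<F>)"
    using \<F> assms(2) by (auto intro: nowhere_dense_in_subset[OF \<F>(2)])
  then show ?thesis
    unfolding meager_in_def by blast
qed

lemma meager_in_UN:
  assumes "countable I" "\<And>i. i \<in> I \<Longrightarrow> meager_in X (S i)"
  shows "meager_in X (\<Union>i\<in>I. S i)"
proof -
  obtain \<F> where \<F>: "\<And>i. i \<in> I \<Longrightarrow> countable (\<F> i)"
    "\<And>i T. i \<in> I \<Longrightarrow> T \<in> \<F> i \<Longrightarrow> nowhere_dense_in X T" "\<And>i. i \<in> I \<Longrightarrow> S i = \<Union>(\<F> i)"
    using assms(2) unfolding meager_in_def by metis
  have "countable (\<Union>i\<in>I. \<F> i)"
    using assms(1) \<F>(1) by (rule countable_UN)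
  moreover have "(\<Union>i\<in>I. S i) = \<Union>(\<Union>i\<in>I. \<F> i)"
    using \<F>(3) by auto
  ultimately show ?thesis
    unfolding meager_in_def using \<F>(2) by (intro exI[of _ "\<Union>i\<in>I. \<F> i"]) blast
qed

lemma nonmeager_in_superset:
  "nonmeager_in X S \<Longrightarrow> S \<subseteq> T \<Longrightarrow> T \<subseteq> topspace X \<Longrightarrow> nonmeager_in X T"
  unfolding nonmeager_in_def using meager_in_subset by blast

lemma nonmeager_in_UN:
  assumes "countable I" "nonmeager_in X (\<Union>i\<in>I. S i)"
  obtains i where "i \<in> I" "nonmeager_in X (S i)"
  using assms meager_in_UN[of I X S] unfolding nonmeager_in_def by blast

text \<open>Let \<open>?V\<close> be the interior in \<open>X\<close> of the closure of
  \<open>F\<close>. Its trace on \<open>S\<close> is relatively open and lies in the relative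
  closure of \<open>F\<close>, hence is empty. So \<open>?V\<close> misses \<open>F\<close>, then
  the closure of \<open>F\<close>, which contains \<open>?V\<close>.\<close>

lemma nowhere_dense_in_subtopology:
  assumes "nowhere_dense_in (subtopology X S) F"
  shows "nowhere_dense_in X F"
proof -
  let ?V = "X interior_of (X closure_of F)"
  have F: "F \<subseteq> topspace X \<inter> S" "subtopology X S interior_of (S \<inter> X closure_of F) = {}"
    using assms by (auto simp: nowhere_dense_in_def closure_of_subtopology inf_absorb2)
  have "?V \<inter> S \<subseteq> subtopology X S interior_of (S \<inter> X closure_of F)"
    using interior_of_subset[of X "X closure_of F"]
    by (intro interior_of_maximal) (auto simp: openin_subtopology intro!: exI[of _ ?V])
  then have "?V \<inter> F = {}"
    using F by auto
  then have "?V \<inter> X closure_of F = {}"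
    by (simp add: openin_Int_closure_of_eq_empty)
  then have "?V = {}"
    using interior_of_subset[of X "X closure_of F"] by blast
  with F show ?thesis
    by (simp add: nowhere_dense_in_def)
qed

text \<open>Meagerness passes from any subspace to the whole space. The converse direction, in
  \<open>nonmeager_in_dense_subspace\<close>, uses density.\<close>

lemma nonmeager_in_subtopology:
  assumes "nonmeager_in X S" "S \<subseteq> T"
  shows "nonmeager_in (subtopology X T) S"
proof -
  have "meager_in X S" if "meager_in (subtopology X T) S"
    using that nowhere_dense_in_subtopology unfolding meager_in_def by blast
  with assms show ?thesis
    by (auto simp: nonmeager_in_def)
qed

lemma nonmeager_in_image:
  assumes f: "continuous_map X Y f"
    and somewhere_dense: "\<And>U. openin X U \<Longrightarrow> U \<noteq> {} \<Longrightarrow> Y interior_of (Y closure_of (f ` U)) \<noteq> {}"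
    and A: "nonmeager_in X A"
  shows "nonmeager_in Y (f ` A)"
proof -
  have nwd: "nowhere_dense_in X {x \<in> topspace X. f x \<in> T}" if T: "nowhere_dense_in Y T" for T
  proof -
    let ?S = "{x \<in> topspace X. f x \<in> T}"
    let ?U = "X interior_of (X closure_of ?S)"
    have "f ` ?U \<subseteq> f ` (X closure_of ?S)"
      by (intro image_mono interior_of_subset)
    also have "\<dots> \<subseteq> Y closure_of (f ` ?S)"
      by (rule continuous_map_image_closure_subset[OF f])
    also have "\<dots> \<subseteq> Y closure_of T"
      by (intro closure_of_mono) auto
    finally have "Y closure_of (f ` ?U) \<subseteq> Y closure_of T"
      by (simp add: closure_of_minimal)
    then have "Y interior_of (Y closure_of (f ` ?U)) = {}"
      using T unfolding nowhere_dense_in_def by (metis interior_of_mono subset_empty)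
    then have "?U = {}"
      using somewhere_dense[of ?U] by auto
    then show ?thesis
      by (simp add: nowhere_dense_in_def)
  qed
  have AX: "A \<subseteq> topspace X"
    using A by (simp add: nonmeager_in_def)
  have "f ` A \<subseteq> topspace Y"
    using continuous_map_image_subset_topspace[OF f] AX by blast
  moreover have "meager_in X A" if mg: "meager_in Y (f ` A)"
  proof -
    obtain \<F> where \<F>: "countable \<F>" "\<And>F. F \<in> \<F> \<Longrightarrow> nowhere_dense_in Y F" "f ` A = \<Union>\<F>"
      using mg unfolding meager_in_def by metis
    let ?G = "(\<lambda>F. {x \<in> topspace X. f x \<in> F}) ` \<F>"
    have "meager_in X (\<Union>?G)"
      unfolding meager_in_def using \<F>(1,2) nwd by (intro exI[of _ ?G]) auto
    moreover have "A \<subseteq> \<Union>?G"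
    proof (rule subsetI)
      fix x assume "x \<in> A"
      then have "f x \<in> \<Union>\<F>" "x \<in> topspace X"
        using \<F>(3) AX by blast+
      then show "x \<in> \<Union>?G"
        by blast
    qed
    ultimately show ?thesis
      using meager_in_subset by blast
  qed
  ultimately show ?thesis
    using A by (auto simp: nonmeager_in_def)
qed

lemma nonmeager_in_open_map_image:
  assumes "continuous_map X Y f" "open_map X Y f" "nonmeager_in X A"
  shows "nonmeager_in Y (f ` A)"
proof (rule nonmeager_in_image[OF assms(1) _ assms(3)])
  fix U assume U: "openin X U" "U \<noteq> {}"
  then have "openin Y (f ` U)"
    using assms(2) by (auto simp: open_map_def)
  then have "f ` U \<subseteq> Y interior_of (Y closure_of (f ` U))"
    by (simp add: closure_of_subset interior_of_maximal openin_subset)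
  then show "Y interior_of (Y closure_of (f ` U)) \<noteq> {}"
    using U by auto
qed

lemma nonmeager_in_homeomorphism_image:
  assumes "homeomorphism S T f g" "nonmeager_in (top_of_set S) A"
  shows "nonmeager_in (top_of_set T) (f ` A)"
proof (rule nonmeager_in_open_map_image[OF _ _ assms(2)])
  show "continuous_map (top_of_set S) (top_of_set T) f"
    using assms(1) by (auto dest: homeomorphism_cont1 homeomorphism_image1)
  show "open_map (top_of_set S) (top_of_set T) f"
    using homeomorphism_imp_open_map[OF assms(1)] unfolding open_map_def by blast
qed

text \<open>The inclusion need not be open, but a relatively open set \<open>S \<inter> V\<close> is
  dense in \<open>V\<close>, so its image is somewhere dense.\<close>

lemma nonmeager_in_dense_subspace:
  assumes "closure S = UNIV" "nonmeager_in (top_of_set S) A"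
  shows "nonmeager_in euclidean A"
proof -
  have "nonmeager_in euclidean (id ` A)"
  proof (rule nonmeager_in_image[OF _ _ assms(2)])
    show "continuous_map (top_of_set S) euclidean id"
      by simp
    fix U assume "openin (top_of_set S) U" "U \<noteq> {}"
    then obtain V where V: "open V" "U = S \<inter> V"
      by (auto simp: openin_open)
    then have "V \<subseteq> closure (id ` U)"
      using open_Int_closure_subset[OF V(1), of S] assms(1) by (simp add: Int_commute)
    then have "V \<subseteq> interior (closure (id ` U))"
      using V(1) by (rule interior_maximal)
    then show "euclidean interior_of (euclidean closure_of (id ` U)) \<noteq> {}"
      using V \<open>U \<noteq> {}\<close> by auto
  qed
  then show ?thesis
    by simp
qed

lemma nowhere_dense_homeomorphism_image:
  fixes f :: "'a::topological_space \<Rightarrow> 'b::topological_space"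
  assumes "homeomorphism UNIV UNIV f g" "closed S" "interior S = {}"
  shows "closed (f ` S)" "nowhere_dense_in euclidean (f ` S)"
proof -
  show cl: "closed (f ` S)"
    using homeomorphism_imp_closed_map[OF assms(1), of S] assms(2) by simp
  have "g ` interior (f ` S) \<subseteq> g ` (f ` S)"
    by (intro image_mono interior_subset)
  also have "\<dots> = S"
    using assms(1) by (auto simp: homeomorphism_def image_image)
  finally have "g ` interior (f ` S) \<subseteq> interior S"
    using homeomorphism_imp_open_map[OF homeomorphism_symD[OF assms(1)], of "interior (f ` S)"]
    by (intro interior_maximal) auto
  then show "nowhere_dense_in euclidean (f ` S)"
    using cl assms(3) by (simp add: nowhere_dense_in_def)
qed

lemma real_translation_homeomorphism:
  fixes q :: real
  shows "homeomorphism UNIV UNIV ((+) q) ((+) (- q))"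
  by (auto simp: homeomorphism_def intro!: continuous_intros)

text \<open>Rational translates of a nonempty open \<open>U\<close> cover the line, so for some
  rational \<open>q\<close> the part of \<open>A\<close> lying in \<open>U\<close> shifted by
  \<open>- q\<close> is nonmeager. Shifting that part by \<open>q\<close> moves it into
  \<open>U\<close>.\<close>

lemma everywhere_nonmeager_rational_translates:
  fixes A :: "real set"
  assumes A: "nonmeager_in euclidean A"
  shows "everywhere_nonmeager (\<Union>q\<in>\<rat>. (+) q ` A)"
  unfolding everywhere_nonmeager_def
proof (intro allI impI, elim conjE)
  fix U :: "real set" assume U: "open U" "U \<noteq> {}"
  let ?B = "\<Union>q\<in>\<rat>. (+) q ` A"
  obtain u where u: "u \<in> U"
    using U by blast
  obtain e where e: "e > 0" "ball u e \<subseteq> U"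
    using U(1) u open_contains_ball by blast
  have cover: "A \<subseteq> (\<Union>q\<in>\<rat>. A \<inter> (+) (- q) ` U)"
  proof
    fix a assume a: "a \<in> A"
    obtain q where q: "q \<in> \<rat>" "u - a < q" "q < u - a + e"
      using Rats_dense_in_real[of "u - a" "u - a + e"] e by auto
    then have "q + a \<in> U"
      using e(2) by (auto simp: dist_real_def subset_iff)
    then have "a \<in> (+) (- q) ` U"
      by (auto intro!: image_eqI[of _ _ "q + a"])
    with a q show "a \<in> (\<Union>q\<in>\<rat>. A \<inter> (+) (- q) ` U)"
      by blast
  qed
  then have "nonmeager_in euclidean (\<Union>q\<in>\<rat>. A \<inter> (+) (- q) ` U)"
    using A nonmeager_in_superset by fastforce
  then obtain q where q: "q \<in> \<rat>" "nonmeager_in euclidean (A \<inter> (+) (- q) ` U)"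
    using nonmeager_in_UN[OF countable_rat] by blast
  have "nonmeager_in euclidean ((+) q ` (A \<inter> (+) (- q) ` U))"
    using nonmeager_in_homeomorphism_image[OF real_translation_homeomorphism, of _ q] q(2) by simp
  moreover have "(+) q ` (A \<inter> (+) (- q) ` U) \<subseteq> ?B \<inter> U"
    using q(1) by auto
  ultimately show "nonmeager_in euclidean (?B \<inter> U)"
    using nonmeager_in_superset by fastforce
qed

section \<open>Extending order isomorphisms\<close>

lemma order_dense_closure_iff:
  fixes S :: "real set"
  shows "closure S = UNIV \<longleftrightarrow> (\<forall>x y. x < y \<longrightarrow> (\<exists>s\<in>S. x < s \<and> s < y))"
proof safe
  fix x y :: real assume "closure S = UNIV" "x < y"
  then show "\<exists>s\<in>S. x < s \<and> s < y"
    using open_Int_closure_eq_empty[of "{x<..<y}" S] by auto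
next
  fix x assume *: "\<forall>x y. x < y \<longrightarrow> (\<exists>s\<in>S. x < s \<and> s < y)"
  show "x \<in> closure S"
    unfolding closure_approachable
  proof (intro allI impI)
    fix e :: real assume "e > 0"
    then obtain s where "s \<in> S" "x < s" "s < x + e"
      using *[rule_format, of x "x + e"] by auto
    then show "\<exists>y\<in>S. dist y x < e"
      by (intro bexI[of _ s]) (auto simp: dist_real_def)
  qed
qed auto

text \<open>The supremum of \<open>f\<close> over the points of \<open>A\<close> up to
  \<open>x\<close> gives a monotone extension. It is strict because two points \<open>a < b\<close>
  of \<open>A\<close> fit between \<open>x\<close> and \<open>y\<close>. Continuity is not claimed,
  as the values of \<open>f\<close> may leave gaps.\<close>

lemma strict_mono_extension:
  fixes f :: "real \<Rightarrow> real"
  assumes dense: "closure A = UNIV" and f: "strict_mono_on A f"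
  obtains h where "strict_mono h" "\<And>a. a \<in> A \<Longrightarrow> h a = f a"
proof
  let ?L = "\<lambda>x. f ` {a \<in> A. a \<le> x}"
  define h where "h x = Sup (?L x)" for x
  have mono: "f a \<le> f b" if "a \<in> A" "b \<in> A" "a \<le> b" for a b
    using f that by (metis le_less strict_mono_onD)
  have between: "\<exists>s\<in>A. x < s \<and> s < y" if "x < y" for x y
    using dense that by (simp add: order_dense_closure_iff)
  have ne: "?L x \<noteq> {}" for x
    using between[of "x - 1" x] by auto
  have upper: "h x \<le> f b" if "b \<in> A" "x \<le> b" for x b
    unfolding h_def using that by (intro cSup_least[OF ne]) (auto intro: mono)
  have bdd: "bdd_above (?L x)" for x
  proof -
    obtain b where "b \<in> A" "x < b"
      using between[of x "x + 1"] by auto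
    then show ?thesis
      by (intro bdd_aboveI[of _ "f b"]) (auto intro: mono)
  qed
  have lower: "f b \<le> h x" if "b \<in> A" "b \<le> x" for x b
    unfolding h_def using that by (intro cSup_upper[OF _ bdd]) auto
  show "h a = f a" if "a \<in> A" for a
    using lower[of a a] upper[of a a] that by simp
  show "strict_mono h"
  proof (rule strict_monoI)
    fix x y :: real assume "x < y"
    then obtain a where a: "a \<in> A" "x < a" "a < y"
      using between by blast
    then obtain b where b: "b \<in> A" "a < b" "b < y"
      using between by blast
    have "h x \<le> f a" "f a < f b" "f b \<le> h y"
      using a b upper lower f by (auto intro: strict_mono_onD)
    then show "h x < h y"
      by simp
  qed
qed

text \<open>A point moved by \<open>k\<close> would jump over a fixed point \<open>a \<in> A\<close>
  lying between \<open>x\<close> and \<open>k x\<close>, against monotonicity.\<close>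

lemma strict_mono_eq_id_if_dense:
  fixes k :: "real \<Rightarrow> real"
  assumes "closure A = UNIV" "strict_mono k" "\<And>a. a \<in> A \<Longrightarrow> k a = a"
  shows "k x = x"
proof (rule ccontr)
  assume "k x \<noteq> x"
  then consider "k x < x" | "x < k x"
    by linarith
  then show False
  proof cases
    case 1
    then obtain a where "a \<in> A" "k x < a" "a < x"
      using assms(1) by (auto simp: order_dense_closure_iff)
    then show False
      using assms(3)[of a] strict_monoD[OF assms(2), of a x] by simp
  next
    case 2
    then obtain a where "a \<in> A" "x < a" "a < k x"
      using assms(1) by (auto simp: order_dense_closure_iff)
    then show False
      using assms(3)[of a] strict_monoD[OF assms(2), of x a] by simp
  qed
qed

text \<open>Extend \<open>f\<close> and its inverse separately. Both composites of the extensions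
  fix a dense set, hence are the identity. The extensions are therefore monotone surjections of the
  line, and such maps are continuous.\<close>

lemma order_isomorphism_extension:
  fixes f :: "real \<Rightarrow> real"
  assumes "closure A = UNIV" "closure B = UNIV" and f: "order_isomorphism f A B"
  obtains h k where "homeomorphism UNIV UNIV h k" "\<And>a. a \<in> A \<Longrightarrow> h a = f a"
proof -
  let ?g = "inv_into A f"
  have bij: "bij_betw f A B" and ord: "\<And>x y. x \<in> A \<Longrightarrow> y \<in> A \<Longrightarrow> x \<le> y \<longleftrightarrow> f x \<le> f y"
    using f by (auto simp: order_isomorphism_def)
  have fsm: "strict_mono_on A f"
    by (rule strict_mono_onI) (metis ord not_le)
  have g: "?g b \<in> A" "f (?g b) = b" if "b \<in> B" for b
    using bij that by (auto simp: bij_betw_def inv_into_into f_inv_into_f)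
  have gf: "?g (f a) = a" if "a \<in> A" for a
    using bij that by (simp add: bij_betw_inv_into_left)
  have fB: "f a \<in> B" if "a \<in> A" for a
    using bij that by (auto simp: bij_betw_def)
  have gsm: "strict_mono_on B ?g"
    by (rule strict_mono_onI) (metis ord not_le g)
  obtain h where h: "strict_mono h" "\<And>a. a \<in> A \<Longrightarrow> h a = f a"
    using strict_mono_extension[OF assms(1) fsm] by blast
  obtain k where k: "strict_mono k" "\<And>b. b \<in> B \<Longrightarrow> k b = ?g b"
    using strict_mono_extension[OF assms(2) gsm] by blast
  have kh: "k (h x) = x" for x
    using strict_mono_eq_id_if_dense[OF assms(1) strict_mono_compose[OF k(1) h(1)], of x]
    by (simp add: h k fB gf)
  have hk: "h (k x) = x" for x
    using strict_mono_eq_id_if_dense[OF assms(2) strict_mono_compose[OF h(1) k(1)], of x]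
    by (simp add: h k g)
  have "range h = UNIV" "range k = UNIV"
    using kh hk by (metis surjI)+
  then have "continuous_on UNIV h" "continuous_on UNIV k"
    using h(1) k(1) by (auto intro!: continuous_onI_mono simp: strict_mono_less_eq)
  then have "homeomorphism UNIV UNIV h k"
    using hk kh \<open>range h = UNIV\<close> \<open>range k = UNIV\<close> by (simp add: homeomorphism_def)
  then show thesis
    using h(2) that by blast
qed

section \<open>Sets of size aleph one\<close>

lemma infinite_if_has_card_aleph1:
  assumes "has_card_aleph1 A"
  shows "infinite A"
proof -
  have "natLeq \<le>o |A|"
    using assms unfolding has_card_aleph1_def
    by (meson cardSuc_ordLeq natLeq_Card_order ordIso_symmetric ordLeq_ordIso_trans)
  then show ?thesis
    using infinite_iff_natLeq_ordLeq by blast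
qed

lemma has_card_aleph1_superset:
  assumes "has_card_aleph1 A" "A \<subseteq> B" "|B| \<le>o |A|"
  shows "has_card_aleph1 B"
proof -
  have "|B| =o |A|"
    using assms card_of_mono1 by (simp add: ordIso_iff_ordLeq)
  then show ?thesis
    using assms(1) ordIso_transitive unfolding has_card_aleph1_def by blast
qed

lemma countable_ordLeq_infinite:
  assumes "countable A" "infinite B"
  shows "|A| \<le>o |B|"
proof -
  obtain f :: "'a \<Rightarrow> nat" where "inj_on f A"
    using assms(1) by (auto simp: countable_def)
  then have "|A| \<le>o |UNIV :: nat set|"
    using card_of_ordLeq by blast
  also have "|UNIV :: nat set| \<le>o |B|"
    using assms(2) by (simp add: infinite_iff_card_of_nat)
  finally show ?thesis .
qed

section \<open>Coding sequences by iterated contractions\<close>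

lemma open_cylinder: "open {y :: nat \<Rightarrow> nat. \<forall>i\<le>n. y i = x i}"
  using product_topology_basis'[of "{..n}" "\<lambda>i. {x i}" id] by (simp add: open_discrete Ball_def)

lemma open_contains_cylinder:
  fixes x :: "nat \<Rightarrow> nat"
  assumes "open U" "x \<in> U"
  obtains n where "{y. \<forall>i\<le>n. y i = x i} \<subseteq> U"
proof -
  obtain X where X: "x \<in> (\<Pi>\<^sub>E i\<in>UNIV. X i)" "finite {i. X i \<noteq> UNIV}" "(\<Pi>\<^sub>E i\<in>UNIV. X i) \<subseteq> U"
    using product_topology_open_contains_basis[of "\<lambda>_. euclidean" UNIV U x] assms
    by (auto simp: open_fun_def)
  obtain n where n: "{i. X i \<noteq> UNIV} \<subseteq> {..n}"
    using finite_nat_iff_bounded_le X(2) by blast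
  have "{y. \<forall>i\<le>n. y i = x i} \<subseteq> (\<Pi>\<^sub>E i\<in>UNIV. X i)"
  proof
    fix y assume y: "y \<in> {y. \<forall>i\<le>n. y i = x i}"
    have "y i \<in> X i" for i
    proof (cases "i \<le> n")
      case True
      then show ?thesis
        using y X(1) by (auto simp: PiE_iff)
    next
      case False
      then show ?thesis
        using n by auto
    qed
    then show "y \<in> (\<Pi>\<^sub>E i\<in>UNIV. X i)"
      by auto
  qed
  from this X(3) have "{y. \<forall>i\<le>n. y i = x i} \<subseteq> U"
    by (rule subset_trans)
  then show thesis
    by (rule that)
qed

abbreviation (input) shift :: "(nat \<Rightarrow> 'a) \<Rightarrow> nat \<Rightarrow> 'a" where
  "shift x \<equiv> \<lambda>i. x (Suc i)"

text \<open>The infinite composition of the maps \<open>G (x 0)\<close>, \<open>G (x 1)\<close>, ...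
  cut off after \<open>n\<close> maps and evaluated at the base point 0.\<close>

primrec code_approx :: "(nat \<Rightarrow> real \<Rightarrow> real) \<Rightarrow> nat \<Rightarrow> (nat \<Rightarrow> nat) \<Rightarrow> real" where
  "code_approx G 0 x = 0"
| "code_approx G (Suc n) x = G (x 0) (code_approx G n (shift x))"

text \<open>A countable iterated function system on a closed set of reals. Since \<open>X\<close>
  may be unbounded, \<open>bounded\<close> supplies the initial estimate that the contractions then
  halve.\<close>

locale contraction_coding =
  fixes G :: "nat \<Rightarrow> real \<Rightarrow> real" and X :: "real set"
  assumes closed_X: "closed X" and zero_in_X: "0 \<in> X"
    and G_in: "\<And>n a. a \<in> X \<Longrightarrow> G n a \<in> X"
    and contraction: "\<And>n a b. a \<in> X \<Longrightarrow> b \<in> X \<Longrightarrow> \<bar>G n a - G n b\<bar> \<le> \<bar>a - b\<bar> / 2"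
    and bounded: "\<And>n a b. a \<in> X \<Longrightarrow> b \<in> X \<Longrightarrow> \<bar>G n a - G n b\<bar> \<le> 1"
begin

definition decode :: "(nat \<Rightarrow> nat) \<Rightarrow> real" where
  "decode x = lim (\<lambda>n. code_approx G n x)"

lemma code_approx_in: "code_approx G n x \<in> X"
  by (induction n arbitrary: x) (auto simp: zero_in_X G_in)

text \<open>The innermost of the \<open>n + 1\<close> shared maps brings the two values within
  distance 1, and each of the other \<open>n\<close> halves the distance. Allowing different depths
  and different sequences serves both the Cauchy property and the continuity of
  \<open>decode\<close>.\<close>

lemma code_approx_close:
  assumes "\<forall>i\<le>n. x i = y i"
  shows "\<bar>code_approx G (Suc n + k) x - code_approx G (Suc n + l) y\<bar> \<le> (1/2) ^ n"
  using assms
proof (induction n arbitrary: x y)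
  case 0
  then show ?case
    by (simp add: bounded code_approx_in)
next
  case (Suc n)
  have "\<bar>code_approx G (Suc (Suc n) + k) x - code_approx G (Suc (Suc n) + l) y\<bar>
      \<le> \<bar>code_approx G (Suc n + k) (shift x) - code_approx G (Suc n + l) (shift y)\<bar> / 2"
    using contraction[OF code_approx_in code_approx_in, of "x 0" "Suc n + k" "shift x" "Suc n + l" "shift y"] Suc.prems
    by simp
  also have "\<dots> \<le> (1/2) ^ n / 2"
    using Suc.IH[of "shift x" "shift y"] Suc.prems by (intro divide_right_mono) auto
  finally show ?case
    by simp
qed

lemma code_approx_tendsto: "(\<lambda>n. code_approx G n x) \<longlonglongrightarrow> decode x"
proof -
  have "Cauchy (\<lambda>n. code_approx G n x)"
  proof (rule metric_CauchyI)
    fix e :: real assume "e > 0"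
    then obtain n where n: "(1/2) ^ n < e"
      using real_arch_pow_inv[of e "1/2"] by auto
    have "dist (code_approx G i x) (code_approx G j x) < e" if "i \<ge> Suc n" "j \<ge> Suc n" for i j
      using code_approx_close[of n x x "i - Suc n" "j - Suc n"] n that by (simp add: dist_real_def)
    then show "\<exists>M. \<forall>i\<ge>M. \<forall>j\<ge>M. dist (code_approx G i x) (code_approx G j x) < e"
      by blast
  qed
  then show ?thesis
    unfolding decode_def using Cauchy_convergent convergent_LIMSEQ_iff by blast
qed

lemma decode_in: "decode x \<in> X"
  using closed_sequentially[OF closed_X _ code_approx_tendsto] code_approx_in by blast

lemma decode_close:
  assumes "\<forall>i\<le>n. x i = y i"
  shows "\<bar>decode x - decode y\<bar> \<le> (1/2) ^ n"
proof -
  have "(\<lambda>k. \<bar>code_approx G (k + Suc n) x - code_approx G (k + Suc n) y\<bar>)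
      \<longlonglongrightarrow> \<bar>decode x - decode y\<bar>"
    by (intro tendsto_intros LIMSEQ_ignore_initial_segment code_approx_tendsto)
  then show ?thesis
    using code_approx_close[OF assms] by (intro LIMSEQ_le_const2) (auto simp: add.commute)
qed

text \<open>This is the limit of the recursion for \<open>code_approx\<close>, since each
  \<open>G n\<close> is continuous on \<open>X\<close>.\<close>

lemma decode_unfold: "decode x = G (x 0) (decode (shift x))"
proof (rule LIMSEQ_unique)
  have "continuous_on X (G (x 0))"
    unfolding continuous_on_iff
  proof (intro ballI allI impI)
    fix a e :: real assume "a \<in> X" "e > 0"
    then have "dist (G (x 0) b) (G (x 0) a) < e" if "b \<in> X" "dist b a < e" for b
      using contraction[of b a "x 0"] that by (auto simp: dist_real_def)
    then show "\<exists>d>0. \<forall>b\<in>X. dist b a < d \<longrightarrow> dist (G (x 0) b) (G (x 0) a) < e"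
      using \<open>e > 0\<close> by blast
  qed
  then show "(\<lambda>n. code_approx G (Suc n) x) \<longlonglongrightarrow> G (x 0) (decode (shift x))"
    using continuous_on_tendsto_compose[OF _ code_approx_tendsto[of "shift x"] decode_in]
    by (simp add: code_approx_in)
  show "(\<lambda>n. code_approx G (Suc n) x) \<longlonglongrightarrow> decode x"
    by (rule LIMSEQ_Suc[OF code_approx_tendsto])
qed

lemma continuous_decode: "continuous_on S decode"
proof -
  have "continuous_on UNIV decode"
    unfolding continuous_on_def
  proof (intro ballI tendstoI)
    fix x :: "nat \<Rightarrow> nat" and e :: real assume "e > 0"
    then obtain n where n: "(1/2) ^ n < e"
      using real_arch_pow_inv[of e "1/2"] by auto
    have "\<forall>y\<in>{y. \<forall>i\<le>n. y i = x i}. dist (decode y) (decode x) < e"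
      using decode_close[of n _ x] n by (auto simp: dist_real_def intro: le_less_trans)
    then show "\<forall>\<^sub>F y in at x. dist (decode y) (decode x) < e"
      unfolding eventually_at_topological using open_cylinder[of n x] by blast
  qed
  then show ?thesis
    using continuous_on_subset by blast
qed

text \<open>Here \<open>d\<close> reads off the first digit and \<open>T\<close> undoes the
  corresponding map. Both \<open>y\<close> and the decoded itinerary of \<open>y\<close> arise by
  applying \<open>G (d y)\<close> to the same pair of points for \<open>T y\<close>, so their
  distance is at most half of the distance there. Iterating makes it arbitrarily small.\<close>

lemma decode_itinerary:
  assumes "S \<subseteq> X" "T ` S \<subseteq> S" "\<And>y. y \<in> S \<Longrightarrow> G (d y) (T y) = y" "y \<in> S"
  shows "decode (\<lambda>i. d ((T ^^ i) y)) = y"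
proof -
  let ?I = "\<lambda>y i. d ((T ^^ i) y)"
  have "\<bar>decode (?I y) - y\<bar> \<le> (1/2) ^ n" if "y \<in> S" for n y
    using that
  proof (induction n arbitrary: y)
    case 0
    then have "T y \<in> X" "G (d y) (T y) = y"
      using assms by auto
    then show ?case
      using bounded[OF decode_in, of "T y" "d y" "shift (?I y)"] decode_unfold[of "?I y"] by simp
  next
    case (Suc n)
    then have *: "T y \<in> S" "T y \<in> X" "G (d y) (T y) = y"
      using assms by auto
    have sh: "shift (?I y) = ?I (T y)"
      by (simp add: funpow_swap1)
    have "decode (?I y) = G (d y) (decode (?I (T y)))"
      using decode_unfold[of "?I y"] sh by simp
    then have "\<bar>decode (?I y) - y\<bar> \<le> \<bar>decode (?I (T y)) - T y\<bar> / 2"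
      using contraction[OF decode_in *(2), of "d y" "?I (T y)"] *(3) by simp
    also have "\<dots> \<le> (1/2) ^ n / 2"
      using Suc.IH[OF *(1)] by simp
    finally show ?case
      by simp
  qed
  then have "\<bar>decode (?I y) - y\<bar> \<le> 0"
    using \<open>y \<in> S\<close> by (intro LIMSEQ_le_const[OF LIMSEQ_power_zero[of "1/2 :: real"]]) auto
  then show ?thesis
    by simp
qed

text \<open>The inverse of \<open>decode\<close> is the itinerary map. It is continuous because
  every coordinate is the continuous digit map \<open>d\<close> after an iterate of
  \<open>T\<close>. The set \<open>K\<close> singles out the admissible digit sequences.\<close>

lemma homeomorphism_decode:
  fixes T :: "real \<Rightarrow> real" and d :: "real \<Rightarrow> nat"
  assumes "S \<subseteq> X" "T ` S \<subseteq> S" "\<And>y. y \<in> S \<Longrightarrow> G (d y) (T y) = y"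
    and T: "continuous_on S T" and d: "continuous_on S d"
    and K: "\<And>x. x \<in> K \<Longrightarrow> shift x \<in> K" "\<And>y. y \<in> S \<Longrightarrow> (\<lambda>i. d ((T ^^ i) y)) \<in> K"
    and dec: "\<And>x. x \<in> K \<Longrightarrow> decode x \<in> S" "\<And>x. x \<in> K \<Longrightarrow> d (decode x) = x 0"
      "\<And>x. x \<in> K \<Longrightarrow> T (decode x) = decode (shift x)"
  shows "homeomorphism K S decode (\<lambda>y i. d ((T ^^ i) y))"
proof -
  \<comment> \<open>On decoded points \<open>T\<close> acts as the shift, so \<open>d\<close> after
    \<open>i\<close> iterates returns digit \<open>i\<close>.\<close>
  have funpow_decode: "(T ^^ i) (decode x) = decode (\<lambda>j. x (j + i)) \<and> (\<lambda>j. x (j + i)) \<in> K"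
    if "x \<in> K" for x i
  proof (induction i)
    case (Suc i)
    let ?x = "\<lambda>j. x (j + i)"
    have "(T ^^ Suc i) (decode x) = decode (shift ?x)"
      using dec(3)[of ?x] Suc by simp
    moreover have "shift ?x \<in> K"
      using K(1)[of ?x] Suc by blast
    ultimately show ?case
      by simp
  qed (simp add: that)
  have itin: "(\<lambda>i. d ((T ^^ i) (decode x))) = x" if "x \<in> K" for x
  proof
    fix i
    show "d ((T ^^ i) (decode x)) = x i"
      using funpow_decode[OF that, of i] dec(2)[of "\<lambda>j. x (j + i)"] by simp
  qed
  have funpow_in: "(T ^^ i) ` S \<subseteq> S" for i
    using assms(2) by (induction i) auto
  have "continuous_on S (T ^^ i)" for i
  proof (induction i)
    case (Suc i)
    have "continuous_on ((T ^^ i) ` S) T"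
      using T funpow_in by (rule continuous_on_subset)
    with Suc show ?case
      unfolding funpow.simps by (rule continuous_on_compose)
  qed simp
  then have "continuous_on S (\<lambda>y. d ((T ^^ i) y))" for i
    using funpow_in by (rule continuous_on_compose2[OF d])
  then have "continuous_on S (\<lambda>y i. d ((T ^^ i) y))"
    by (rule continuous_on_coordinatewise_then_product)
  moreover have dec_itin: "decode (\<lambda>i. d ((T ^^ i) y)) = y" if "y \<in> S" for y
    by (rule decode_itinerary[OF assms(1,2,3) that])
  ultimately show ?thesis
    by (intro homeomorphismI continuous_decode image_subsetI dec(1) K(2) itin)
qed

end

section \<open>The irrationals and the middle-third set\<close>

text \<open>An increasing homeomorphism of the line onto the open unit interval that maps rationals
  to rationals. It takes the place of the reciprocal in continued fractions, with Lipschitz constant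
  1/2.\<close>

definition squash :: "real \<Rightarrow> real" where
  "squash t = (1 + t / (1 + \<bar>t\<bar>)) / 2"

text \<open>The inverse on the open unit interval. The \<open>min\<close> merges the formulas for
  the halves below and above 1/2, which correspond to negative and positive arguments of
  \<open>squash\<close>.\<close>

definition unsquash :: "real \<Rightarrow> real" where
  "unsquash y = (2 * y - 1) / (2 * min y (1 - y))"

lemma squash_gt_0: "0 < squash t" and squash_less_1: "squash t < 1"
  by (auto simp: squash_def field_simps abs_if)

lemma squash_nonneg: "0 \<le> t \<Longrightarrow> squash t = 1 - 1 / (2 * (1 + t))"
  by (simp add: squash_def field_simps)

lemma squash_nonpos: "t \<le> 0 \<Longrightarrow> squash t = 1 / (2 * (1 - t))"
  by (simp add: squash_def field_simps)

lemma unsquash_squash: "unsquash (squash t) = t"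
proof (cases "0 \<le> t")
  case True
  then have "1 / 2 \<le> squash t" "2 * squash t - 1 = t / (1 + t)" "2 * (1 - squash t) = 1 / (1 + t)"
    unfolding squash_nonneg[OF True] by (simp_all add: field_simps)
  then have "2 * squash t - 1 = t / (1 + t)" "2 * min (squash t) (1 - squash t) = 1 / (1 + t)"
    by simp_all
  then show ?thesis
    unfolding unsquash_def using True by simp
next
  case False
  then have "squash t \<le> 1 / 2" "2 * squash t - 1 = t / (1 - t)" "2 * squash t = 1 / (1 - t)"
    by (simp_all add: squash_nonpos field_simps)
  then have "2 * squash t - 1 = t / (1 - t)" "2 * min (squash t) (1 - squash t) = 1 / (1 - t)"
    by simp_all
  then show ?thesis
    unfolding unsquash_def using False by simp
qed

lemma squash_unsquash:
  assumes "0 < y" "y < 1"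
  shows "squash (unsquash y) = y"
proof (cases "y \<le> 1 / 2")
  case True
  then have u: "unsquash y = (2 * y - 1) / (2 * y)"
    by (simp add: unsquash_def min_def)
  have "unsquash y \<le> 0"
    unfolding u using True assms by (intro divide_nonpos_pos) auto
  then show ?thesis
    using assms by (simp add: squash_nonpos u field_simps)
next
  case False
  then have u: "unsquash y = (2 * y - 1) / (2 * (1 - y))"
    by (simp add: unsquash_def min_def)
  with False assms have "0 \<le> unsquash y"
    by simp
  then show ?thesis
    using assms by (simp add: squash_nonneg u field_simps)
qed

text \<open>For arguments of equal sign the difference of the quotients is the difference of the
  arguments divided by a product of factors at least 1. For opposite signs each quotient is closer
  to 0 than its argument.\<close>

lemma squash_contraction: "\<bar>squash a - squash b\<bar> \<le> \<bar>a - b\<bar> / 2"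
proof -
  have *: "\<bar>s / (1 + \<bar>s\<bar>) - t / (1 + \<bar>t\<bar>)\<bar> \<le> \<bar>s - t\<bar>" if "s \<le> t" for s t :: real
  proof -
    consider "0 \<le> s" | "t \<le> 0" | "s < 0" "0 < t"
      by linarith
    then show ?thesis
    proof cases
      case 1
      then have "t / (1 + t) - s / (1 + s) = (t - s) / ((1 + s) * (1 + t))"
        using that by (simp add: field_simps)
      moreover have "(t - s) / ((1 + s) * (1 + t)) \<le> t - s"
        using divide_left_mono[of 1 "(1 + s) * (1 + t)" "t - s"] mult_mono[of 1 "1 + s" 1 "1 + t"] 1 that
        by simp
      moreover have "0 \<le> (t - s) / ((1 + s) * (1 + t))"
        using 1 that by simp
      ultimately have "0 \<le> t / (1 + t) - s / (1 + s)" "t / (1 + t) - s / (1 + s) \<le> t - s"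
        by simp_all
      then show ?thesis
        using 1 that by simp
    next
      case 2
      then have "t / (1 - t) - s / (1 - s) = (t - s) / ((1 - s) * (1 - t))"
        using that by (simp add: field_simps)
      moreover have "(t - s) / ((1 - s) * (1 - t)) \<le> t - s"
        using divide_left_mono[of 1 "(1 - s) * (1 - t)" "t - s"] mult_mono[of 1 "1 - s" 1 "1 - t"] 2 that
        by simp
      moreover have "0 \<le> (t - s) / ((1 - s) * (1 - t))"
        using 2 that by simp
      ultimately have "0 \<le> t / (1 - t) - s / (1 - s)" "t / (1 - t) - s / (1 - s) \<le> t - s"
        by simp_all
      then show ?thesis
        using 2 that by simp
    next
      case 3
      have "0 \<le> t / (1 + t)" "t / (1 + t) \<le> t" "s / (1 - s) \<le> 0" "s \<le> s / (1 - s)"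
        using 3 by (auto simp: field_simps)
      then have "\<bar>s / (1 - s) - t / (1 + t)\<bar> \<le> t - s"
        by linarith
      then show ?thesis
        using 3 by simp
    qed
  qed
  have "\<bar>a / (1 + \<bar>a\<bar>) - b / (1 + \<bar>b\<bar>)\<bar> \<le> \<bar>a - b\<bar>"
    using *[of a b] *[of b a] by (cases "a \<le> b") (auto simp: abs_minus_commute)
  then show ?thesis
    by (simp add: squash_def diff_divide_distrib[symmetric] add_divide_distrib[symmetric])
qed

lemma squash_in_Rats: "t \<in> \<rat> \<Longrightarrow> squash t \<in> \<rat>"
  by (simp add: squash_def)

text \<open>Digit \<open>n\<close> stands for the integer \<open>int_decode n\<close>, and its map
  sends the line into the open unit interval above that integer. Thus the floor recovers the first
  digit and the fractional part recovers the tail.\<close>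

interpretation baire: contraction_coding "\<lambda>n a. of_int (int_decode n) + squash a" UNIV
proof
  fix n :: nat and a b :: real
  show "\<bar>of_int (int_decode n) + squash a - (of_int (int_decode n) + squash b)\<bar> \<le> \<bar>a - b\<bar> / 2"
    using squash_contraction[of a b] by simp
  show "\<bar>of_int (int_decode n) + squash a - (of_int (int_decode n) + squash b)\<bar> \<le> 1"
    using squash_gt_0[of a] squash_gt_0[of b] squash_less_1[of a] squash_less_1[of b] by simp
qed auto

lemma floor_baire_decode: "\<lfloor>baire.decode x\<rfloor> = int_decode (x 0)"
  unfolding baire.decode_unfold[of x]
  using squash_gt_0[of "baire.decode (shift x)"] squash_less_1[of "baire.decode (shift x)"]
  by (simp add: floor_eq_iff)

lemma frac_baire_decode: "frac (baire.decode x) = squash (baire.decode (shift x))"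
  unfolding frac_def floor_baire_decode by (subst baire.decode_unfold) simp

text \<open>Descent on denominators: if \<open>squash b = s / q\<close> with \<open>0 < s < q\<close>, then
  \<open>b = (2s - q) / (2 min s (q - s))\<close>, whose denominator is smaller than \<open>q\<close> unless
  \<open>b = 0\<close>.\<close>

lemma baire_decode_irrational: "baire.decode x \<notin> \<rat>"
proof -
  \<comment> \<open>This rules out the value 0, the only one at which the descent on denominators
    stops.\<close>
  have no_int: "baire.decode x \<notin> \<int>" for x
    using squash_gt_0[of "baire.decode (shift x)"] frac_baire_decode[of x]
    by (metis frac_eq_0_iff less_irrefl)
  have "baire.decode x * of_int q \<noteq> of_int r" if "q > 0" for x q r
    using that
  proof (induction "nat q" arbitrary: x q r rule: less_induct)
    case less
    show ?case
    proof
      assume r: "baire.decode x * of_int q = of_int r"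
      define b where "b = baire.decode (shift x)"
      define s where "s = r - int_decode (x 0) * q"
      have s: "squash b * of_int q = of_int s"
        using r baire.decode_unfold[of x] by (simp add: b_def s_def algebra_simps)
      have b: "b * (2 * min (squash b) (1 - squash b)) = 2 * squash b - 1"
        using unsquash_squash[of b] squash_gt_0[of b] squash_less_1[of b]
        by (simp add: unsquash_def field_simps min_def)
      have "min (squash b) (1 - squash b) * of_int q
          = min (squash b * of_int q) ((1 - squash b) * of_int q)"
        using less.prems by (simp add: min_mult_distrib_right)
      then have m: "min (squash b) (1 - squash b) * of_int q = of_int (min s (q - s))"
        by (simp add: left_diff_distrib s of_int_min)
      have "b * (2 * (min (squash b) (1 - squash b) * of_int q)) = 2 * (squash b * of_int q) - of_int q"
        using arg_cong[OF b, of "\<lambda>u. u * of_int q"] by (simp add: algebra_simps)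
      then have eq: "b * of_int (2 * min s (q - s)) = of_int (2 * s - q)"
        unfolding m s by simp
      have "0 < real_of_int s" "real_of_int s < of_int q"
        using less.prems squash_gt_0[of b] squash_less_1[of b] by (auto simp flip: s)
      then have sq: "0 < s" "s < q"
        by simp_all
      show False
      proof (cases "2 * min s (q - s) < q")
        case True
        then have "b * of_int (2 * min s (q - s)) \<noteq> of_int (2 * s - q)"
          unfolding b_def using sq by (intro less.hyps) auto
        with eq show False
          by contradiction
      next
        \<comment> \<open>Neither of \<open>s\<close> and \<open>q - s\<close> is then below
          \<open>q / 2\<close>, and they add up to \<open>q\<close>, so they coincide.\<close>
        case False
        then have "2 * s - q = 0"
          by (simp add: min_def split: if_splits)
        then have "b * of_int (2 * min s (q - s)) = 0"
          using eq by simp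
        moreover have "min s (q - s) \<noteq> 0"
          using sq by (simp add: min_def)
        ultimately have "b = 0"
          by simp
        then show False
          using no_int[of "shift x"] by (simp add: b_def)
      qed
    qed
  qed
  then have *: "baire.decode x \<noteq> of_int r / of_int q" if "q > 0" for q r
    using that by (metis less_irrefl nonzero_divide_eq_eq of_int_0_less_iff)
  show ?thesis
  proof
    assume "baire.decode x \<in> \<rat>"
    then obtain r :: int and n :: nat where "n > 0" "baire.decode x = of_int r / of_nat n"
      by (auto simp: Rats_eq_int_div_nat)
    then show False
      using *[of "int n" r] by simp
  qed
qed

text \<open>The tail map \<open>unsquash (frac y)\<close> keeps irrationals irrational because
  \<open>squash\<close> maps rationals to rationals. Floor and \<open>frac\<close> are continuous on
  the irrationals, which avoid the integers.\<close>

lemma baire_homeomorphism: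
  "homeomorphism UNIV (- \<rat>) baire.decode (\<lambda>y i. int_encode \<lfloor>((\<lambda>y. unsquash (frac y)) ^^ i) y\<rfloor>)"
proof (rule baire.homeomorphism_decode)
  have sub: "(- \<rat> :: real set) \<subseteq> UNIV - \<int>"
    using Ints_subset_Rats by blast
  have frac01: "0 < frac y" "frac y < 1" if "y \<notin> \<rat>" for y :: real
    using that sub by (auto simp: frac_lt_1)
  have frac_cont: "continuous_on (- \<rat>) (frac :: real \<Rightarrow> real)"
    unfolding frac_def
    by (intro continuous_intros continuous_on_subset[OF continuous_on_of_int_floor sub])
  have "2 * min (frac y) (1 - frac y) \<noteq> 0" if "y \<in> - \<rat>" for y :: real
    using frac01[of y] that by (simp add: min_def)
  then show "continuous_on (- \<rat>) (\<lambda>y. unsquash (frac y))"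
    unfolding unsquash_def by (intro continuous_intros frac_cont) auto
  have "continuous_on (- \<rat> :: real set) (\<lambda>y. of_int \<lfloor>y\<rfloor> :: int)"
    by (rule continuous_on_subset[OF continuous_on_of_int_floor sub])
  then have "continuous_on (- \<rat> :: real set) (int_encode \<circ> (\<lambda>y. \<lfloor>y\<rfloor>))"
    by (intro continuous_on_compose Topological_Spaces.continuous_on_discrete) simp
  then show "continuous_on (- \<rat> :: real set) (\<lambda>y. int_encode \<lfloor>y\<rfloor>)"
    by (simp add: o_def)
  show unfold: "of_int (int_decode (int_encode \<lfloor>y\<rfloor>)) + squash (unsquash (frac y)) = y"
    if "y \<in> - \<rat>" for y :: real
    using frac01[of y] that by (simp add: squash_unsquash) (simp add: frac_def)
  show "(\<lambda>y. unsquash (frac y)) ` (- \<rat>) \<subseteq> - \<rat>"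
  proof safe
    fix y :: real assume "y \<notin> \<rat>" "unsquash (frac y) \<in> \<rat>"
    then show False
      using squash_in_Rats[of "unsquash (frac y)"] unfold[of y]
      by (metis ComplI Rats_add Rats_of_int)
  qed
  show "baire.decode x \<in> - \<rat>" for x
    using baire_decode_irrational by simp
  show "int_encode \<lfloor>baire.decode x\<rfloor> = x 0" for x
    by (simp add: floor_baire_decode)
  show "unsquash (frac (baire.decode x)) = baire.decode (shift x)" for x
    by (simp add: frac_baire_decode unsquash_squash)
qed auto

text \<open>The two similarities generating the middle-third set. All nonzero digits act alike, so
  sequences with entries at most 1 are the ones decoded injectively.\<close>

interpretation cantor: contraction_coding
  "\<lambda>n a. if n = 0 then a / 3 else a / 3 + 2 / 3" "{0..1}"
  by standard (auto simp: abs_if)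

text \<open>Self-similarity holds stage by stage, and whether \<open>y \<le> 1 / 3\<close> decides
  the same alternative for all stages, so the intersection can be taken.\<close>

lemma middle_third_cases:
  assumes "y \<in> middle_third_set"
  shows "0 \<le> y \<and> y \<le> 1 / 3 \<and> 3 * y \<in> middle_third_set \<or>
    2 / 3 \<le> y \<and> y \<le> 1 \<and> 3 * y - 2 \<in> middle_third_set"
proof -
  have stage01: "cantor_stage n \<subseteq> {0..1}" for n
    by (induction n) auto
  have stage: "y \<in> cantor_stage n" for n
    using assms by (simp add: middle_third_set_def)
  have "0 \<le> y \<and> y \<le> 1 / 3 \<and> 3 * y \<in> cantor_stage n \<or>
      2 / 3 \<le> y \<and> y \<le> 1 \<and> 3 * y - 2 \<in> cantor_stage n" for n
    using stage[of "Suc n"] stage01[of n] by auto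
  then show ?thesis
    unfolding middle_third_set_def by (cases "y \<le> 1 / 3") (force, force)
qed

lemma cantor_homeomorphism:
  "homeomorphism {x. \<forall>i. x i \<le> 1} middle_third_set cantor.decode
     (\<lambda>y i. if ((\<lambda>y. if y \<le> 1 / 2 then 3 * y else 3 * y - 2) ^^ i) y \<le> 1 / 2 then 0 else 1)"
    (is "homeomorphism ?K ?S _ (\<lambda>y i. if (?T ^^ i) y \<le> 1 / 2 then 0 else 1)")
proof (rule cantor.homeomorphism_decode[where d = "\<lambda>y. if y \<le> 1 / 2 then 0 else 1"])
  show "?S \<subseteq> {0..1}"
    using middle_third_cases by fastforce
  show "?T ` ?S \<subseteq> ?S"
    using middle_third_cases by fastforce
  \<comment> \<open>The threshold lies in the removed middle third, which makes the digit map and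
    the expanding map continuous on the set.\<close>
  have not_half: "1 / 2 \<notin> ?S"
    using middle_third_cases[of "1 / 2"] by auto
  show "continuous_on ?S ?T"
    by (intro continuous_on_cases_le continuous_intros) (use not_half in auto)
  show "continuous_on ?S (\<lambda>y. if y \<le> 1 / 2 then 0 else 1 :: nat)"
    by (intro continuous_on_cases_le continuous_intros) (use not_half in auto)
  show decode_in: "cantor.decode x \<in> ?S" for x
  proof -
    have "cantor.decode x \<in> cantor_stage n" for n
    proof (induction n arbitrary: x)
      case 0
      show ?case
        using cantor.decode_in by simp
    next
      case (Suc n)
      show ?case
        by (subst cantor.decode_unfold) (use Suc[of "shift x"] in auto)
    qed
    then show ?thesis
      by (simp add: middle_third_set_def)
  qed
  show "(if cantor.decode x \<le> 1 / 2 then 0 else 1) = x 0" if "x \<in> ?K" for x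
  proof -
    have "x 0 \<le> 1"
      using that by simp
    then show ?thesis
      using cantor.decode_in[of "shift x"] by (subst cantor.decode_unfold) auto
  qed
  show "?T (cantor.decode x) = cantor.decode (shift x)" for x
    using cantor.decode_in[of "shift x"] by (subst (1 2 3) cantor.decode_unfold[of x]) auto
qed (auto simp: diff_divide_distrib)

section \<open>Homeomorphic copies meeting a nonmeager set\<close>

lemma range_compose_eq: "range ((\<circ>) v) = {y. \<forall>i. y i \<in> range v}"
proof (intro set_eqI iffI)
  fix y assume "y \<in> {y. \<forall>i. y i \<in> range v}"
  then have "y = v \<circ> (\<lambda>i. inv v (y i))"
    by (auto simp: fun_eq_iff f_inv_into_f)
  then show "y \<in> range ((\<circ>) v)"
    by blast
qed auto

lemma continuous_compose_discrete:
  fixes v :: "'a::discrete_topology \<Rightarrow> 'b::topological_space"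
  shows "continuous_on S ((\<circ>) v :: ('c \<Rightarrow> 'a) \<Rightarrow> _)"
proof (rule continuous_on_coordinatewise_then_product)
  fix i
  have "continuous_on S (\<lambda>x :: 'c \<Rightarrow> 'a. x i)"
    using continuous_on_product_coordinates by (rule continuous_on_subset) simp
  then show "continuous_on S (\<lambda>x :: 'c \<Rightarrow> 'a. (v \<circ> x) i)"
    unfolding o_apply
    by (rule continuous_on_compose2[OF Topological_Spaces.continuous_on_discrete[of UNIV v]]) simp
qed

text \<open>If \<open>y = v \<circ> w\<close> agrees with \<open>v \<circ> x\<close> up to
  \<open>n\<close>, then replacing the entries of \<open>w\<close> up to \<open>n\<close> by those
  of \<open>x\<close> leaves \<open>v \<circ> w\<close> unchanged and moves \<open>w\<close> into
  the cylinder around \<open>x\<close> inside \<open>U\<close>.\<close>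

lemma open_map_compose:
  fixes v :: "nat \<Rightarrow> nat" and U :: "(nat \<Rightarrow> nat) set"
  assumes "open U"
  shows "openin (top_of_set (range ((\<circ>) v))) ((\<circ>) v ` U)"
proof (subst openin_subopen, intro ballI)
  fix z assume "z \<in> (\<circ>) v ` U"
  then obtain x where x: "x \<in> U" "z = v \<circ> x"
    by blast
  obtain n where n: "{y. \<forall>i\<le>n. y i = x i} \<subseteq> U"
    using open_contains_cylinder[OF assms x(1)] .
  let ?T = "range ((\<circ>) v) \<inter> {y. \<forall>i\<le>n. y i = z i}"
  have "?T \<subseteq> (\<circ>) v ` U"
  proof (rule subsetI)
    fix y assume y: "y \<in> ?T"
    then obtain w where w: "y = v \<circ> w"
      by blast
    let ?w = "\<lambda>i. if i \<le> n then x i else w i"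
    have "?w \<in> U"
      by (rule subsetD[OF n]) simp
    moreover have "v \<circ> ?w = y"
      using y by (auto simp: w x(2) fun_eq_iff)
    ultimately show "y \<in> (\<circ>) v ` U"
      by blast
  qed
  moreover have "openin (top_of_set (range ((\<circ>) v))) ?T"
    by (rule openin_open_Int[OF open_cylinder])
  moreover have "z \<in> ?T"
    using x(2) by blast
  ultimately show "\<exists>T. openin (top_of_set (range ((\<circ>) v))) T \<and> z \<in> T \<and> T \<subseteq> (\<circ>) v ` U"
    by blast
qed

lemma closed_range_compose:
  fixes v :: "nat \<Rightarrow> nat"
  shows "closed (range ((\<circ>) v) :: (nat \<Rightarrow> nat) set)"
proof -
  have "closed ((\<lambda>y :: nat \<Rightarrow> nat. y i) -` range v)" for i
    by (intro closed_vimage continuous_on_product_coordinates) (simp add: closed_def open_discrete)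
  then have "closed (\<Inter>i. (\<lambda>y :: nat \<Rightarrow> nat. y i) -` range v)"
    by blast
  moreover have "range ((\<circ>) v) = (\<Inter>i. (\<lambda>y :: nat \<Rightarrow> nat. y i) -` range v)"
    unfolding range_compose_eq by blast
  ultimately show ?thesis
    by simp
qed

text \<open>Every cylinder contains a sequence taking the missed value \<open>c\<close> just beyond
  the fixed coordinates.\<close>

lemma interior_range_compose:
  fixes v :: "nat \<Rightarrow> nat"
  assumes "range v \<noteq> UNIV"
  shows "interior (range ((\<circ>) v) :: (nat \<Rightarrow> nat) set) = {}"
proof (rule ccontr)
  assume "interior (range ((\<circ>) v) :: (nat \<Rightarrow> nat) set) \<noteq> {}"
  then obtain x where x: "x \<in> interior (range ((\<circ>) v) :: (nat \<Rightarrow> nat) set)"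
    by blast
  obtain n where n: "{y. \<forall>i\<le>n. y i = x i} \<subseteq> interior (range ((\<circ>) v))"
    using open_contains_cylinder[OF open_interior x] .
  obtain c where c: "c \<notin> range v"
    using assms by blast
  have "x(Suc n := c) \<in> interior (range ((\<circ>) v))"
    by (rule subsetD[OF n]) simp
  then have "x(Suc n := c) \<in> range ((\<circ>) v)"
    using interior_subset by blast
  then have "(x(Suc n := c)) (Suc n) \<in> range v"
    unfolding range_compose_eq by blast
  with c show False
    by simp
qed

text \<open>The copy of \<open>N\<close> is produced by a homeomorphism of the whole Baire space, so
  that closedness and nowhere density of \<open>N\<close> carry over to it.\<close>

lemma nonmeager_homeomorphic_copy:
  fixes A :: "(nat \<Rightarrow> nat) set" and v :: "nat \<Rightarrow> nat"
  defines "N \<equiv> range ((\<circ>) v) :: (nat \<Rightarrow> nat) set"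
  assumes nonmeager_subset: "\<And>A :: real set. nonmeager_in euclidean A \<Longrightarrow>
      \<exists>B \<subseteq> A. nonmeager_in euclidean B \<and> has_card_aleph1 B"
    and isomorphic: "\<And>A B A0 B0 :: real set.
      \<lbrakk>everywhere_nonmeager A; everywhere_nonmeager B; has_card_aleph1 A; has_card_aleph1 B;
       A0 \<subseteq> A; countable A0; A \<subseteq> closure A0; B0 \<subseteq> B; countable B0; B \<subseteq> closure B0\<rbrakk> \<Longrightarrow>
      \<exists>f. order_isomorphism f A B \<and> f ` A0 = B0"
    and A: "nonmeager_in euclidean A"
  obtains \<kappa> \<kappa>' :: "(nat \<Rightarrow> nat) \<Rightarrow> nat \<Rightarrow> nat" where "homeomorphism UNIV UNIV \<kappa> \<kappa>'"
    "nonmeager_in (top_of_set (\<kappa> ` N)) (A \<inter> \<kappa> ` N)"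
proof -
  obtain e e' where e: "homeomorphism (UNIV :: (nat \<Rightarrow> nat) set) (- \<rat> :: real set) e e'"
    using baire_homeomorphism by blast
  have e_irr: "e x \<notin> \<rat>" and e'_e: "e' (e x) = x" for x
    using e by (auto simp: homeomorphism_def)
  have rat_dense: "closure \<rat> = (UNIV :: real set)"
    unfolding order_dense_closure_iff using Rats_dense_in_real by blast
  have irr_dense: "closure (- \<rat>) = (UNIV :: real set)"
    unfolding order_dense_closure_iff
  proof (intro allI impI)
    fix x y :: real assume "x < y"
    then show "\<exists>s\<in>- \<rat>. x < s \<and> s < y"
      using open_minus_countable[OF countable_rat, of "{x<..<y}"] by auto
  qed
  have "nonmeager_in euclidean (e ` A)"
    using nonmeager_in_homeomorphism_image[OF e] A nonmeager_in_dense_subspace[OF irr_dense] by simp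
  then obtain B where B: "B \<subseteq> e ` A" "nonmeager_in euclidean B" "has_card_aleph1 B"
    using nonmeager_subset by blast
  have B_irr: "B \<subseteq> - \<rat>"
    using B(1) e_irr by auto
  have A': "nonmeager_in euclidean (e' ` B)" "e' ` B \<subseteq> A"
    using nonmeager_in_homeomorphism_image[OF homeomorphism_symD[OF e] nonmeager_in_subtopology[OF B(2) B_irr]]
      B(1) e'_e by auto
  define M where "M = (\<circ>) v ` e' ` B"
  have M: "nonmeager_in (top_of_set N) M"
    unfolding M_def N_def
  proof (rule nonmeager_in_open_map_image[OF _ _ A'(1)])
    show "continuous_map euclidean (top_of_set (range ((\<circ>) v))) ((\<circ>) v :: (nat \<Rightarrow> nat) \<Rightarrow> _)"
      using continuous_compose_discrete[of UNIV v] by (simp add: continuous_map_in_subtopology)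
    show "open_map euclidean (top_of_set (range ((\<circ>) v))) ((\<circ>) v :: (nat \<Rightarrow> nat) \<Rightarrow> _)"
      unfolding open_map_def by (auto intro: open_map_compose)
  qed
  define C where "C = (\<Union>q\<in>\<rat>. (+) q ` B)"
  \<comment> \<open>Stated for supersets of \<open>C\<close>, like the cardinality claim
    \<open>card1\<close> below, to serve both sides of the isomorphism.\<close>
  have ev: "everywhere_nonmeager D" if "C \<subseteq> D" for D
    unfolding everywhere_nonmeager_def
  proof (intro allI impI)
    fix U :: "real set" assume "open U \<and> U \<noteq> {}"
    then have "nonmeager_in euclidean (C \<inter> U)"
      using everywhere_nonmeager_rational_translates[OF B(2)] unfolding C_def everywhere_nonmeager_def
      by blast
    then show "nonmeager_in euclidean (D \<inter> U)"
      by (rule nonmeager_in_superset) (use that in auto)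
  qed
  have infB: "infinite B"
    using B(3) by (rule infinite_if_has_card_aleph1)
  have ratB: "|\<rat> :: real set| \<le>o |B|"
    using countable_ordLeq_infinite[OF countable_rat infB] .
  have "|e ` M| \<le>o |B|"
    unfolding M_def image_image by (rule card_of_image)
  moreover have "|C| \<le>o |B|"
    unfolding C_def using infB ratB
    by (rule card_of_UNION_ordLeq_infinite) (simp add: card_of_image)
  ultimately have card_D: "|C \<union> e ` M \<union> \<rat>| \<le>o |B|"
    using infB ratB by (intro card_of_Un_ordLeq_infinite_Field) (simp_all add: Field_card_of card_of_card_order_on)
  have BC: "B \<subseteq> C"
    using UN_upper[of 0 \<rat> "\<lambda>q. (+) q ` B"] by (simp add: C_def)
  have card1: "has_card_aleph1 D" if "C \<subseteq> D" "D \<subseteq> C \<union> e ` M \<union> \<rat>" for D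
  proof (rule has_card_aleph1_superset[OF B(3)])
    show "B \<subseteq> D"
      using BC that(1) by (rule subset_trans)
    show "|D| \<le>o |B|"
      using card_of_mono1[OF that(2)] card_D by (rule ordLeq_transitive)
  qed
  \<comment> \<open>The rationals are adjoined to both sides to act as both countable dense subsets.
    Since \<open>f\<close> preserves them, its extension also preserves the irrationals.\<close>
  have "\<exists>f. order_isomorphism f (C \<union> \<rat>) (C \<union> e ` M \<union> \<rat>) \<and> f ` \<rat> = \<rat>"
    by (rule isomorphic) (auto intro!: ev card1 simp: rat_dense countable_rat)
  then obtain f where f: "order_isomorphism f (C \<union> \<rat>) (C \<union> e ` M \<union> \<rat>)" "f ` \<rat> = \<rat>"
    by blast
  have closure_UNIV: "closure D = UNIV" if "\<rat> \<subseteq> D" for D :: "real set"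
    using closure_mono[OF that] rat_dense by blast
  have "closure (C \<union> \<rat>) = UNIV" "closure (C \<union> e ` M \<union> \<rat>) = UNIV"
    by (rule closure_UNIV, blast)+
  then obtain h k where hk: "homeomorphism UNIV UNIV h k" "\<And>a. a \<in> C \<union> \<rat> \<Longrightarrow> h a = f a"
    using order_isomorphism_extension[OF _ _ f(1)] by blast
  have k_h: "k (h x) = x" and h_k: "h (k x) = x" for x
    using hk(1) by (auto simp: homeomorphism_def)
  have h_rat: "h ` \<rat> = \<rat>"
    using hk(2) f(2) by (simp cong: image_cong)
  have k_rat: "k x \<in> \<rat> \<longleftrightarrow> x \<in> \<rat>" for x
    using h_rat k_h h_k by (metis image_iff)
  have k_M: "k (e m) \<in> C" if "m \<in> M" for m
  proof -
    have "e m \<in> f ` (C \<union> \<rat>)"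
      using f(1) that by (auto simp: order_isomorphism_def bij_betw_def)
    then obtain a where a: "a \<in> C \<union> \<rat>" "e m = f a"
      by blast
    then have "k (e m) = a"
      using hk(2) k_h by metis
    \<comment> \<open>The point \<open>a\<close> is irrational because \<open>e m\<close> is, which
      leaves only \<open>C\<close>.\<close>
    then show ?thesis
      using a(1) k_rat[of "e m"] e_irr[of m] by auto
  qed
  have "M \<subseteq> (\<Union>q\<in>\<rat>. {m \<in> M. - q + k (e m) \<in> B})"
  proof (rule subsetI)
    fix m assume m: "m \<in> M"
    then obtain q b where "q \<in> \<rat>" "b \<in> B" "k (e m) = q + b"
      using k_M[OF m] unfolding C_def by blast
    with m show "m \<in> (\<Union>q\<in>\<rat>. {m \<in> M. - q + k (e m) \<in> B})"
      by (intro UN_I[of q]) simp_all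
  qed
  then have "nonmeager_in (top_of_set N) (\<Union>q\<in>\<rat>. {m \<in> M. - q + k (e m) \<in> B})"
    using M by (intro nonmeager_in_superset[OF M]) (auto simp: nonmeager_in_def)
  then obtain q where q: "q \<in> \<rat>" "nonmeager_in (top_of_set N) {m \<in> M. - q + k (e m) \<in> B}"
    by (rule nonmeager_in_UN[OF countable_rat])
  \<comment> \<open>Both \<open>k\<close> and the translation by \<open>- q\<close> restrict to the
    irrationals, so conjugating by \<open>e\<close> yields a homeomorphism of the Baire
    space.\<close>
  have k_irr: "homeomorphism (- \<rat>) (- \<rat>) k h"
  proof (rule homeomorphism_of_subsets[OF homeomorphism_symD[OF hk(1)]])
    show "k ` (- \<rat>) = - \<rat>"
    proof (rule set_eqI)
      fix x
      have "x \<in> k ` (- \<rat>) \<longleftrightarrow> h x \<in> - \<rat>"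
        using k_h[of x] h_k by (metis image_iff)
      also have "\<dots> \<longleftrightarrow> x \<in> - \<rat>"
        using k_rat[of "h x"] k_h[of x] by simp
      finally show "x \<in> k ` (- \<rat>) \<longleftrightarrow> x \<in> - \<rat>" .
    qed
  qed simp_all
  have t_irr: "homeomorphism (- \<rat>) (- \<rat>) ((+) (- q)) ((+) (- (- q)))"
  proof (rule homeomorphism_of_subsets[OF real_translation_homeomorphism])
    have iff: "q + x \<in> \<rat> \<longleftrightarrow> x \<in> \<rat>" for x
      using Rats_add[OF q(1), of x] Rats_diff[OF _ q(1), of "q + x"] by (metis add_diff_cancel_left')
    show "(+) (- q) ` (- \<rat>) = - \<rat>"
    proof (intro equalityI subsetI)
      fix x assume "x \<in> (+) (- q) ` (- \<rat>)"
      then obtain y where "y \<notin> \<rat>" "y = q + x"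
        by auto
      then show "x \<in> - \<rat>"
        using iff by simp
    next
      fix x :: real assume "x \<in> - \<rat>"
      then have "q + x \<in> - \<rat>"
        using iff by simp
      then show "x \<in> (+) (- q) ` (- \<rat>)"
        by (rule rev_image_eqI) simp
    qed
  qed simp_all
  define \<kappa> where "\<kappa> = e' \<circ> ((+) (- q) \<circ> (k \<circ> e))"
  obtain \<kappa>' where \<kappa>: "homeomorphism UNIV UNIV \<kappa> \<kappa>'"
    unfolding \<kappa>_def
    using homeomorphism_compose[OF homeomorphism_compose[OF homeomorphism_compose[OF e k_irr] t_irr]
        homeomorphism_symD[OF e]] by blast
  have "homeomorphism N (\<kappa> ` N) \<kappa> \<kappa>'"
    by (rule homeomorphism_of_subsets[OF \<kappa>]) auto
  then have "nonmeager_in (top_of_set (\<kappa> ` N)) (\<kappa> ` {m \<in> M. - q + k (e m) \<in> B})"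
    using q(2) by (rule nonmeager_in_homeomorphism_image)
  moreover have "\<kappa> ` {m \<in> M. - q + k (e m) \<in> B} \<subseteq> A \<inter> \<kappa> ` N"
    using A'(2) unfolding \<kappa>_def M_def N_def by auto
  ultimately have "nonmeager_in (top_of_set (\<kappa> ` N)) (A \<inter> \<kappa> ` N)"
    by (rule nonmeager_in_superset) simp
  with \<kappa> show thesis
    by (rule that)
qed

theorem theorem3p4:
  assumes "\<And>A :: real set. nonmeager_in euclidean A \<Longrightarrow>
             \<exists>B \<subseteq> A. nonmeager_in euclidean B \<and> has_card_aleph1 B"
    and "\<And>A B A0 B0 :: real set.
           \<lbrakk>everywhere_nonmeager A; everywhere_nonmeager B;
            has_card_aleph1 A; has_card_aleph1 B;
            A0 \<subseteq> A; countable A0; A \<subseteq> closure A0;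
            B0 \<subseteq> B; countable B0; B \<subseteq> closure B0\<rbrakk> \<Longrightarrow>
           \<exists>f. order_isomorphism f A B \<and> f ` A0 = B0"
  shows "cantor_baire_space \<and> baire_baire_space"
proof -
  have copy: "\<exists>P. closed P \<and> nowhere_dense_in euclidean P \<and> P homeomorphic (range ((\<circ>) v) :: (nat \<Rightarrow> nat) set) \<and>
      nonmeager_in (top_of_set P) (A \<inter> P)"
    if A: "nonmeager_in euclidean A" and v: "range v \<noteq> UNIV"
    for A :: "(nat \<Rightarrow> nat) set" and v :: "nat \<Rightarrow> nat"
  proof -
    let ?N = "range ((\<circ>) v) :: (nat \<Rightarrow> nat) set"
    obtain \<kappa> \<kappa>' where \<kappa>: "homeomorphism UNIV UNIV \<kappa> \<kappa>'"
      "nonmeager_in (top_of_set (\<kappa> ` ?N)) (A \<inter> \<kappa> ` ?N)"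
      using nonmeager_homeomorphic_copy[OF assms A] .
    have "homeomorphism ?N (\<kappa> ` ?N) \<kappa> \<kappa>'"
      by (rule homeomorphism_of_subsets[OF \<kappa>(1)]) auto
    then have "\<kappa> ` ?N homeomorphic ?N"
      using homeomorphic_def homeomorphic_sym by blast
    with \<kappa>(2) nowhere_dense_homeomorphism_image[OF \<kappa>(1) closed_range_compose interior_range_compose[OF v]]
    show ?thesis
      by blast
  qed
  have "range (\<lambda>k :: nat. k mod 2) = {..1}"
  proof (intro set_eqI iffI)
    fix k :: nat assume "k \<in> {..1}"
    then have "k = k mod 2"
      by simp
    then show "k \<in> range (\<lambda>k. k mod 2)"
      by blast
  qed auto
  then have mod2: "range (\<lambda>k :: nat. k mod 2) \<noteq> UNIV"
    "range ((\<circ>) (\<lambda>k :: nat. k mod 2)) = {x :: nat \<Rightarrow> nat. \<forall>i. x i \<le> 1}"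
    unfolding range_compose_eq by (auto simp: set_eq_iff)
  have cantor: "{x :: nat \<Rightarrow> nat. \<forall>i. x i \<le> 1} homeomorphic middle_third_set"
    using cantor_homeomorphism homeomorphic_def by blast
  have "cantor_baire_space"
    unfolding cantor_baire_space_def is_Cantor_set_def
    using copy[OF _ mod2(1)] homeomorphic_trans[OF _ cantor] unfolding mod2(2) by blast
  moreover have double: "range ((*) (2 :: nat)) \<noteq> UNIV"
    by (metis UNIV_I dvd_triv_left imageE odd_one)
  \<comment> \<open>Halving inverts doubling on the left, and coordinatewise maps of discrete values
    are continuous in both directions.\<close>
  have "homeomorphism (UNIV :: baire_space set) (range ((\<circ>) ((*) 2))) ((\<circ>) ((*) 2)) ((\<circ>) (\<lambda>k. k div 2))"
  proof (rule homeomorphismI)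
    show half: "(\<lambda>k. k div 2) \<circ> ((*) 2 \<circ> x) = x" for x :: baire_space
      by (simp add: comp_def)
    show "(*) 2 \<circ> ((\<lambda>k. k div 2) \<circ> y) = y" if y: "y \<in> range ((\<circ>) ((*) 2))" for y :: baire_space
    proof -
      obtain x where "y = (*) 2 \<circ> x"
        using y by (rule imageE)
      then show ?thesis
        by (simp only: half)
    qed
  qed (rule continuous_compose_discrete subset_refl subset_UNIV)+
  then have "(UNIV :: baire_space set) homeomorphic range ((\<circ>) ((*) 2) :: baire_space \<Rightarrow> _)"
    unfolding homeomorphic_def by (intro exI)
  then have double_homeomorphic: "range ((\<circ>) ((*) 2) :: baire_space \<Rightarrow> _) homeomorphic (UNIV :: baire_space set)"
    by (rule homeomorphic_sym[THEN iffD1])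
  then have "baire_baire_space"
    unfolding baire_baire_space_def
    using copy[OF _ double] homeomorphic_trans[OF _ double_homeomorphic] by blast
  ultimately show ?thesis
    by blast
qed

end
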